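(* Let $\mathbb{X}$ be a reflexive real Banach space and let $\mathbb{Y}$ be any real normed linear space. Then for any compact linear operators $T, A \in \mathbb{K}(\mathbb{X},\mathbb{Y})$, $T \perp_B A$ if and only if there exist $x, y \in M_T$ such that $Ax \in (Tx)^+$ and $Ay \in (Ty)^-$.
   Context: All normed linear spaces are real. $\mathbb{K}(\mathbb{X},\mathbb{Y})$ is the space of compact linear operators from $\mathbb{X}$ to $\mathbb{Y}$, with the operator norm. $S_{\mathbb{X}} = \{x \in \mathbb{X} : \|x\| = 1\}$. Birkhoff-James orthogonality: for operators $T, A$, $T \perp_B A$ means $\|T\| \le \|T + \lambda A\|$ for all $\lambda \in \mathbb{R}$. The norm attainment set of $T$ is $M_T = \{x \in S_{\mathbb{X}} : \|Tx\| = \|T\|\}$. For elements $u, v$ of a real normed linear space, $v \in u^+$ means $\|u + \lambda v\| \ge \|u\|$ for all $\lambda \ge 0$, and $v \in u^-$ means $\|u + \lambda v\| \ge \|u\|$ for all $\lambda \le 0$. *)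

theory Defs
  imports "HOL-Analysis.Bounded_Linear_Function"
begin

definition bidual_embedding :: "'a::real_normed_vector \<Rightarrow> (('a \<Rightarrow>\<^sub>L real) \<Rightarrow>\<^sub>L real)" where
  "bidual_embedding x = Blinfun (\<lambda>f. blinfun_apply f x)"

text \<open>\<open>Blinfun\<close> is unspecified on functions that are not bounded linear; this shows that
  \<open>bidual_embedding\<close> is indeed evaluation.\<close>

lemma bidual_embedding_apply [simp]:
  "blinfun_apply (bidual_embedding x) f = blinfun_apply f x"
  unfolding bidual_embedding_def
  by (simp add: bounded_linear_Blinfun_apply bounded_linear_blinfun_apply blinfun.bounded_linear_left)

definition reflexive_space :: "'a::real_normed_vector itself \<Rightarrow> bool" where
  "reflexive_space _ \<longleftrightarrow> surj (bidual_embedding :: 'a \<Rightarrow> (('a \<Rightarrow>\<^sub>L real) \<Rightarrow>\<^sub>L real))"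

definition compact_operators :: "('a::real_normed_vector \<Rightarrow>\<^sub>L 'b::real_normed_vector) set" where
  "compact_operators = {T. \<forall>S. bounded S \<longrightarrow> compact (closure (blinfun_apply T ` S))}"

definition birkhoff_james_orthogonal :: "'a::real_normed_vector \<Rightarrow> 'a \<Rightarrow> bool" where
  "birkhoff_james_orthogonal u v \<longleftrightarrow> (\<forall>l::real. norm u \<le> norm (u + l *\<^sub>R v))"

definition norm_attainment_set ::
  "('a::real_normed_vector \<Rightarrow>\<^sub>L 'b::real_normed_vector) \<Rightarrow> 'a set" where
  "norm_attainment_set T = {x \<in> sphere 0 1. norm (blinfun_apply T x) = norm T}"

definition plus_set :: "'a::real_normed_vector \<Rightarrow> 'a set" where
  "plus_set u = {v. \<forall>l::real. l \<ge> 0 \<longrightarrow> norm (u + l *\<^sub>R v) \<ge> norm u}"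

definition minus_set :: "'a::real_normed_vector \<Rightarrow> 'a set" where
  "minus_set u = {v. \<forall>l::real. l \<le> 0 \<longrightarrow> norm (u + l *\<^sub>R v) \<ge> norm u}"

end

theory Submission
  imports Defs
begin

text \<open>
  For the forward implication, let \<open>x\<^sub>n\<close> almost attain the norm of \<open>T + s\<^sub>n A\<close>, up to an error
  \<open>s\<^sub>n\<^sup>2\<close>, where \<open>s\<^sub>n\<close> decreases to \<open>0\<close>. Orthogonality and convexity of
  \<open>l \<mapsto> norm (T x\<^sub>n + l A x\<^sub>n)\<close> give \<open>norm (T x\<^sub>n + l A x\<^sub>n) \<ge> norm T - l s\<^sub>n\<close> for
  \<open>l \<ge> s\<^sub>n\<close>. By reflexivity and compactness, \<open>(T x\<^sub>n, A x\<^sub>n)\<close> has a cluster point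
  \<open>(T a, A a)\<close> with \<open>a\<close> in the unit ball, and the limit inequality shows that \<open>a\<close> is the
  vector sought. Replacing \<open>A\<close> by \<open>- A\<close> yields the second vector.

  The weak cluster point \<open>a\<close> is obtained without any weak compactness theorem: a linear functional
  on the dual dominated by the sublinear \<open>f \<mapsto> limsup f(x\<^sub>n)\<close> exists by Hahn--Banach and
  is evaluation at some \<open>a\<close> by reflexivity.
\<close>

section \<open>The Hahn--Banach theorem\<close>

definition sublinear :: "('a::real_vector \<Rightarrow> real) \<Rightarrow> bool" where
  "sublinear p \<longleftrightarrow>
    (\<forall>x y. p (x + y) \<le> p x + p y) \<and> (\<forall>c x. c \<ge> 0 \<longrightarrow> p (c *\<^sub>R x) = c * p x)"

text \<open>One inequality suffices for positive homogeneity: applied with \<open>inverse c\<close>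
  to \<open>c *\<^sub>R x\<close>, it gives the reverse one.\<close>

lemma sublinearI:
  assumes "\<And>x y. p (x + y) \<le> p x + p y"
    and "\<And>c x. c > 0 \<Longrightarrow> p (c *\<^sub>R x) \<le> c * p x"
    and "p 0 = 0"
  shows "sublinear p"
  unfolding sublinear_def
proof (intro conjI allI impI)
  fix c :: real and x
  assume "c \<ge> 0"
  show "p (c *\<^sub>R x) = c * p x"
  proof (cases "c = 0")
    case False
    with \<open>c \<ge> 0\<close> have "c > 0" by simp
    then have "p (inverse c *\<^sub>R (c *\<^sub>R x)) \<le> inverse c * p (c *\<^sub>R x)"
      by (intro assms) simp
    then have "c * p x \<le> p (c *\<^sub>R x)"
      using \<open>c > 0\<close> by (simp add: field_simps)
    with assms(2)[OF \<open>c > 0\<close>, of x] show ?thesis by simp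
  qed (simp add: assms)
qed (rule assms)

lemma sublinear_add: "sublinear p \<Longrightarrow> p (x + y) \<le> p x + p y"
  and sublinear_scaleR: "sublinear p \<Longrightarrow> c \<ge> 0 \<Longrightarrow> p (c *\<^sub>R x) = c * p x"
  unfolding sublinear_def by auto

lemma sublinear_zero: "sublinear p \<Longrightarrow> p 0 = 0"
  using sublinear_scaleR[of p 0 0] by simp

lemma sublinear_neg: "sublinear p \<Longrightarrow> - p (- x) \<le> p x"
  using sublinear_add[of p x "- x"] sublinear_zero[of p] by simp

lemma sublinear_norm: "sublinear norm"
  by (rule sublinearI) (auto simp: norm_triangle_ineq)

text \<open>Supplies the lower bounds of chains for Zorn's lemma. The infimum is finite because
  \<open>q x\<close> is at least \<open>- q (- x)\<close>, hence at least
  \<open>- p (- x)\<close>.\<close>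

lemma sublinear_INF_chain:
  fixes C :: "('a::real_vector \<Rightarrow> real) set"
  assumes "C \<noteq> {}" and sub: "\<And>q. q \<in> C \<Longrightarrow> sublinear q \<and> q \<le> p"
    and chain: "\<And>q r. q \<in> C \<Longrightarrow> r \<in> C \<Longrightarrow> q \<le> r \<or> r \<le> q"
  shows "sublinear (\<lambda>x. INF q\<in>C. q x)" and "\<And>q. q \<in> C \<Longrightarrow> (\<lambda>x. INF q\<in>C. q x) \<le> q"
proof -
  have bdd: "bdd_below ((\<lambda>q. q x) ` C)" for x
  proof (rule bdd_belowI2)
    fix q assume "q \<in> C"
    then have "sublinear q" "q (- x) \<le> p (- x)" using sub by (auto simp: le_fun_def)
    then show "- p (- x) \<le> q x" using sublinear_neg[of q x] by simp
  qed
  have low: "(INF q\<in>C. q x) \<le> q x" if "q \<in> C" for q x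
    using bdd that by (rule cINF_lower)
  then show "\<And>q. q \<in> C \<Longrightarrow> (\<lambda>x. INF q\<in>C. q x) \<le> q"
    by (simp add: le_fun_def)
  show "sublinear (\<lambda>x. INF q\<in>C. q x)"
  proof (rule sublinearI)
    fix x y
    have "(INF q\<in>C. q (x + y)) \<le> q x + r y" if qr: "q \<in> C" "r \<in> C" for q r
    proof -
      \<comment> \<open>In a chain the smaller of \<open>q\<close> and \<open>r\<close> serves as
        \<open>s\<close>, so two independent infima can be compared with a single sublinear
        functional.\<close>
      obtain s where s: "s \<in> C" "s \<le> q" "s \<le> r" using chain[OF qr] qr by blast
      have "(INF q\<in>C. q (x + y)) \<le> s x + s y"
        using low[OF s(1), of "x + y"] sublinear_add[of s x y] sub[OF s(1)] by simp
      also have "\<dots> \<le> q x + r y" using s by (simp add: le_fun_def add_mono)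
      finally show ?thesis .
    qed
    then have "(INF q\<in>C. q (x + y)) - r y \<le> (INF q\<in>C. q x)" if "r \<in> C" for r
      using that \<open>C \<noteq> {}\<close> by (intro cINF_greatest) (auto simp: algebra_simps)
    then have "(INF q\<in>C. q (x + y)) - (INF q\<in>C. q x) \<le> (INF q\<in>C. q y)"
      using \<open>C \<noteq> {}\<close> by (intro cINF_greatest) (auto simp: algebra_simps)
    then show "(INF q\<in>C. q (x + y)) \<le> (INF q\<in>C. q x) + (INF q\<in>C. q y)" by simp
  next
    fix c :: real and x :: 'a assume "c > 0"
    have "(INF q\<in>C. q (c *\<^sub>R x)) / c \<le> q x" if "q \<in> C" for q
      using low[OF that, of "c *\<^sub>R x"] sub[OF that] \<open>c > 0\<close>
      by (simp add: sublinear_scaleR field_simps)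
    then have "(INF q\<in>C. q (c *\<^sub>R x)) / c \<le> (INF q\<in>C. q x)"
      using \<open>C \<noteq> {}\<close> by (intro cINF_greatest) auto
    then show "(INF q\<in>C. q (c *\<^sub>R x)) \<le> c * (INF q\<in>C. q x)"
      using \<open>c > 0\<close> by (simp add: field_simps)
  next
    have "(\<lambda>q. q 0) ` C = {0}"
      using \<open>C \<noteq> {}\<close> sub sublinear_zero by (auto simp: image_iff)
    then show "(INF q\<in>C. q 0) = 0" by simp
  qed
qed

text \<open>Lowers \<open>p\<close> as far as needed to force the value at \<open>- v\<close> down
  to \<open>- p v\<close>. The infimum over \<open>t\<close> below does this; \<open>t = 0\<close>
  gives \<open>q \<le> p\<close> and \<open>t = 1\<close> the last bound, which becomes
  superadditivity when \<open>p\<close> is minimal.\<close>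

lemma sublinear_reduce:
  fixes p :: "'a::real_vector \<Rightarrow> real"
  assumes "sublinear p"
  obtains q where "sublinear q" "q \<le> p" "q (- v) \<le> - p v"
    "\<And>w. q w \<le> p (w + v) - p v"
proof -
  define q where "q w = (INF t\<in>{0..}. p (w + t *\<^sub>R v) - t * p v)" for w
  \<comment> \<open>Keeps the infimum finite: \<open>t *\<^sub>R v\<close> is the sum of
    \<open>w + t *\<^sub>R v\<close> and \<open>- w\<close>.\<close>
  have bd: "- p (- w) \<le> p (w + t *\<^sub>R v) - t * p v" if "t \<ge> 0" for w t
    using sublinear_add[OF assms, of "w + t *\<^sub>R v" "- w"] sublinear_scaleR[OF assms that, of v]
    by simp
  have low: "q w \<le> p (w + t *\<^sub>R v) - t * p v" if "t \<ge> 0" for w t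
    unfolding q_def using that bd by (intro cINF_lower bdd_belowI2) auto
  have great: "c \<le> q w" if "\<And>t. t \<ge> 0 \<Longrightarrow> c \<le> p (w + t *\<^sub>R v) - t * p v" for c w
    unfolding q_def using that by (intro cINF_greatest) auto
  have "sublinear q"
  proof (rule sublinearI)
    fix x y
    have "q (x + y) \<le> (p (x + s *\<^sub>R v) - s * p v) + (p (y + t *\<^sub>R v) - t * p v)"
      if "s \<ge> 0" "t \<ge> 0" for s t
      using low[of "s + t" "x + y"] that
        sublinear_add[OF assms, of "x + s *\<^sub>R v" "y + t *\<^sub>R v"]
      by (simp add: algebra_simps)
    then have "q (x + y) - (p (y + t *\<^sub>R v) - t * p v) \<le> q x" if "t \<ge> 0" for t
      using that by (intro great) (simp add: algebra_simps)
    then have "q (x + y) - q x \<le> q y"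
      by (intro great) (simp add: algebra_simps)
    then show "q (x + y) \<le> q x + q y" by simp
  next
    fix c :: real and x assume c: "c > 0"
    have "q (c *\<^sub>R x) / c \<le> q x"
    proof (rule great)
      fix t :: real assume t: "t \<ge> 0"
      have "q (c *\<^sub>R x) \<le> p (c *\<^sub>R (x + t *\<^sub>R v)) - (c * t) * p v"
        using low[of "c * t" "c *\<^sub>R x"] c t by (simp add: scaleR_add_right)
      also have "\<dots> = c * (p (x + t *\<^sub>R v) - t * p v)"
        using c sublinear_scaleR[OF assms, of c "x + t *\<^sub>R v"] by (simp add: right_diff_distrib)
      finally have "q (c *\<^sub>R x) \<le> c * (p (x + t *\<^sub>R v) - t * p v)" .
      then show "q (c *\<^sub>R x) / c \<le> p (x + t *\<^sub>R v) - t * p v"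
        using c by (simp add: pos_divide_le_eq mult.commute)
    qed
    then show "q (c *\<^sub>R x) \<le> c * q x" using c by (simp add: field_simps)
  next
    have "q 0 \<le> 0" using low[of 0 0] sublinear_zero[OF assms] by simp
    moreover have "0 \<le> q 0" by (rule great) (simp add: sublinear_scaleR[OF assms])
    ultimately show "q 0 = 0" by simp
  qed
  moreover have "q \<le> p" using low[of 0] by (simp add: le_fun_def)
  moreover have "q w \<le> p (w + v) - p v" for w using low[of 1] by simp
  moreover from this[of "- v"] have "q (- v) \<le> - p v"
    using sublinear_zero[OF assms] by simp
  ultimately show thesis by (intro that)
qed

text \<open>A minimal sublinear functional is linear, since it cannot be reduced in any direction as in the previous lemma.\<close>

theorem sublinear_dominates_linear:
  fixes p :: "'a::real_vector \<Rightarrow> real"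
  assumes "sublinear p"
  obtains f where "linear f" "\<And>x. f x \<le> p x"
proof -
  let ?S = "{q. sublinear q \<and> q \<le> p}"
  \<comment> \<open>The order is reversed, so that a maximal element for Zorn's lemma is a minimal
    functional.\<close>
  let ?R = "relation_of (\<lambda>q r. r \<le> q) ?S"
  have "\<exists>m\<in>?S. \<forall>q\<in>?S. q \<le> m \<longrightarrow> q = m"
  proof (rule predicate_Zorn)
    show "partial_order_on ?S ?R"
      by (rule partial_order_on_relation_ofI) auto
    fix C assume C: "C \<in> Chains ?R"
    show "\<exists>u\<in>?S. \<forall>q\<in>C. u \<le> q"
    proof (cases "C = {}")
      case True
      with assms show ?thesis by auto
    next
      case False
      have sub: "sublinear q \<and> q \<le> p" if "q \<in> C" for q
        using C that by (auto simp: Chains_def relation_of_def)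
      have chain: "q \<le> r \<or> r \<le> q" if "q \<in> C" "r \<in> C" for q r
        using C that by (auto simp: Chains_def relation_of_def)
      have inf: "sublinear (\<lambda>x. INF q\<in>C. q x)"
        by (rule sublinear_INF_chain(1)[OF False]) (fact sub, fact chain)
      have low: "(\<lambda>x. INF q\<in>C. q x) \<le> q" if "q \<in> C" for q
        by (rule sublinear_INF_chain(2)[OF False _ _ that]) (fact sub, fact chain)
      obtain q where "q \<in> C" using False by auto
      have "(\<lambda>x. INF q\<in>C. q x) \<le> p"
        using low[OF \<open>q \<in> C\<close>] sub[OF \<open>q \<in> C\<close>] by (meson order_trans)
      with inf low show ?thesis by blast
    qed
  qed
  then obtain m where m: "sublinear m" "m \<le> p"
    and min: "\<And>q. sublinear q \<Longrightarrow> q \<le> m \<Longrightarrow> q = m"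
    by (auto intro: order_trans)
  \<comment> \<open>By minimality the reduction of \<open>m\<close> along \<open>v\<close> is
    \<open>m\<close> itself, so its bound at \<open>w\<close> turns into superadditivity.\<close>
  have super: "m w + m v \<le> m (w + v)" for v w
  proof -
    obtain q where "sublinear q" "q \<le> m" "q w \<le> m (w + v) - m v"
      using sublinear_reduce[OF m(1), of v] by metis
    with min[of q] show ?thesis by auto
  qed
  have add: "m (w + v) = m w + m v" for v w
    using super[of w v] sublinear_add[OF m(1), of w v] by simp
  have neg: "m (- w) = - m w" for w
    using add[of w "- w"] sublinear_zero[OF m(1)] by simp
  have "m (c *\<^sub>R w) = c * m w" for c w
  proof (cases "c \<ge> 0")
    case False
    then have "m ((- c) *\<^sub>R w) = (- c) * m w"
      by (intro sublinear_scaleR[OF m(1)]) simp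
    then show ?thesis using neg[of "c *\<^sub>R w"] by simp
  qed (simp add: sublinear_scaleR[OF m(1)])
  with add have "linear m" by (intro linearI) simp_all
  then show thesis using m(2) by (intro that) (auto simp: le_fun_def)
qed

text \<open>Reducing the norm along \<open>x\<close> first gives
  \<open>q (- x) \<le> - norm x\<close>, so every linear functional below \<open>q\<close> is at
  least \<open>norm x\<close> at \<open>x\<close>; domination by the norm gives equality.\<close>

corollary norming_functional:
  fixes x :: "'a::real_normed_vector"
  obtains f :: "'a \<Rightarrow>\<^sub>L real" where "\<And>y. f y \<le> norm y" "f x = norm x"
proof -
  obtain q :: "'a \<Rightarrow> real" where q: "sublinear q" "q \<le> norm" "q (- x) \<le> - norm x"
    using sublinear_reduce[OF sublinear_norm, of x] by metis
  obtain f where f: "linear f" "\<And>y. f y \<le> q y"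
    using sublinear_dominates_linear[OF q(1)] by metis
  have le: "f y \<le> norm y" for y
    using f(2)[of y] q(2) by (auto simp: le_fun_def intro: order_trans)
  have neg: "f (- y) = - f y" for y using f(1) by (rule linear_neg)
  have "bounded_linear f"
  proof (rule bounded_linear_intro[where K = 1])
    show "norm (f y) \<le> norm y * 1" for y
      using le[of y] le[of "- y"] by (simp add: neg)
  qed (use f(1) in \<open>auto simp: linear_add linear_scale\<close>)
  moreover have "f x = norm x"
    using le[of x] f(2)[of "- x"] q(3) by (simp add: neg)
  ultimately show thesis
    using le that[of "Blinfun f"] by (simp add: bounded_linear_Blinfun_apply)
qed

section \<open>Weak cluster points in reflexive spaces\<close>

text \<open>Upper bounds alone are enough: for \<open>- f\<close> they become lower bounds, so
  \<open>f a\<close> lies between the limits inferior and superior of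
  \<open>f (x n)\<close>.\<close>

lemma reflexive_weak_cluster_point:
  fixes x :: "nat \<Rightarrow> 'a::real_normed_vector"
  assumes "reflexive_space TYPE('a)" and ball: "\<And>n. norm (x n) \<le> 1"
  obtains a where "norm a \<le> 1"
    "\<And>(f :: 'a \<Rightarrow>\<^sub>L real) c. (\<forall>\<^sub>F n in sequentially. f (x n) \<le> c) \<Longrightarrow> f a \<le> c"
proof -
  \<comment> \<open>\<open>B f\<close> collects the eventual upper bounds of \<open>f (x n)\<close>,
    so its infimum \<open>p f\<close> is the limit superior. It contains \<open>norm f\<close> and
    is bounded below by \<open>- norm f\<close>, so this real infimum is meaningful.\<close>
  define B where "B f = {c::real. \<forall>\<^sub>F n in sequentially. blinfun_apply f (x n) \<le> c}"
    for f :: "'a \<Rightarrow>\<^sub>L real"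
  define p where "p f = Inf (B f)" for f
  have abs_le: "\<bar>f (x n)\<bar> \<le> norm f" for f :: "'a \<Rightarrow>\<^sub>L real" and n
    using norm_blinfun[of f "x n"] mult_left_mono[OF ball[of n] norm_ge_zero[of f]] by simp
  have mem: "norm f \<in> B f" for f
    unfolding B_def using abs_le[of f] by (auto intro!: always_eventually simp: abs_le_iff)
  have lb: "- norm f \<le> c" if "c \<in> B f" for f c
  proof -
    from that obtain n where "f (x n) \<le> c"
      unfolding B_def by (auto simp: eventually_sequentially)
    with abs_le[of f n] show ?thesis by simp
  qed
  have low: "p f \<le> c" if "c \<in> B f" for f c
    unfolding p_def using that lb by (intro cInf_lower bdd_belowI) auto
  have great: "c \<le> p f" if "\<And>b. b \<in> B f \<Longrightarrow> c \<le> b" for f c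
    unfolding p_def using that mem[of f] by (intro cInf_greatest) auto
  have "sublinear p"
  proof (rule sublinearI)
    fix f g
    have "p (f + g) \<le> b + c" if "b \<in> B f" "c \<in> B g" for b c
      using that unfolding B_def
      by (intro low) (auto simp: B_def plus_blinfun.rep_eq elim: eventually_elim2)
    then have "p (f + g) - c \<le> p f" if "c \<in> B g" for c
      using that by (intro great) (simp add: algebra_simps)
    then have "p (f + g) - p f \<le> p g"
      by (intro great) (simp add: algebra_simps)
    then show "p (f + g) \<le> p f + p g" by simp
  next
    fix c :: real and f assume c: "c > 0"
    have "p (c *\<^sub>R f) \<le> c * b" if "b \<in> B f" for b
      using that c by (intro low) (simp add: B_def scaleR_blinfun.rep_eq)
    then have "p (c *\<^sub>R f) / c \<le> p f"
      using c by (intro great) (simp add: pos_divide_le_eq mult.commute)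
    then show "p (c *\<^sub>R f) \<le> c * p f"
      using c by (simp add: field_simps)
  next
    show "p 0 = 0"
      using low[OF mem, of 0] great[of 0 0] lb[of _ 0] by simp
  qed
  then obtain \<phi> where \<phi>: "linear \<phi>" "\<And>f. \<phi> f \<le> p f"
    using sublinear_dominates_linear by metis
  have le: "\<phi> f \<le> norm f" for f
    using \<phi>(2)[of f] low[OF mem, of f] by simp
  have "bounded_linear \<phi>"
  proof (rule bounded_linear_intro[where K = 1])
    show "norm (\<phi> f) \<le> norm f * 1" for f
      using le[of f] le[of "- f"] by (simp add: linear_neg[OF \<phi>(1)])
  qed (use \<phi>(1) in \<open>auto simp: linear_add linear_scale\<close>)
  then have ev: "blinfun_apply (Blinfun \<phi>) = \<phi>" by (rule bounded_linear_Blinfun_apply)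
  obtain a where "bidual_embedding a = Blinfun \<phi>"
    using assms(1) unfolding reflexive_space_def by (metis surj_def)
  then have a: "f a = \<phi> f" for f :: "'a \<Rightarrow>\<^sub>L real"
    using ev by (metis bidual_embedding_apply)
  have bd: "f a \<le> c" if "\<forall>\<^sub>F n in sequentially. f (x n) \<le> c" for f :: "'a \<Rightarrow>\<^sub>L real" and c
    using a[of f] \<phi>(2)[of f] low[of c f] that by (simp add: B_def)
  obtain f :: "'a \<Rightarrow>\<^sub>L real" where f: "\<And>y. f y \<le> norm y" "f a = norm a"
    using norming_functional by metis
  have "norm a \<le> 1"
    using bd[of f 1] f order_trans[OF f(1) ball] by (auto intro: always_eventually)
  then show thesis using bd by (rule that)
qed

text \<open>A weak cluster point \<open>a\<close> of preimages is mapped to the limit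
  \<open>z\<close>: composing with \<open>K\<close> a functional that norms \<open>K a - z\<close>
  gives a functional on the domain, to which the cluster property applies.\<close>

lemma reflexive_closed_image_cball:
  fixes K :: "'a::real_normed_vector \<Rightarrow> 'b::real_normed_vector"
  assumes "reflexive_space TYPE('a)" and "bounded_linear K"
  shows "closed (K ` cball 0 1)"
proof (unfold closed_sequential_limits, intro allI impI, elim conjE)
  fix y z assume "\<forall>n. y n \<in> K ` cball 0 1" and lim: "y \<longlonglongrightarrow> z"
  then obtain x where x: "\<And>n. norm (x n) \<le> 1" "\<And>n. y n = K (x n)"
    by (simp add: image_iff Bex_def) metis
  obtain a where a: "norm a \<le> 1" and
    cl: "\<And>(f :: 'a \<Rightarrow>\<^sub>L real) c. (\<forall>\<^sub>F n in sequentially. f (x n) \<le> c) \<Longrightarrow> f a \<le> c"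
    by (rule reflexive_weak_cluster_point[where x = x, OF assms(1) x(1)]) blast
  obtain g :: "'b \<Rightarrow>\<^sub>L real" where g: "\<And>y. g y \<le> norm y" "g (K a - z) = norm (K a - z)"
    using norming_functional by metis
  have K: "blinfun_apply (Blinfun K) = K"
    using assms(2) by (rule bounded_linear_Blinfun_apply)
  have "g (K a) \<le> g z + e" if "e > 0" for e
  proof -
    have "(\<lambda>n. g (y n)) \<longlonglongrightarrow> g z" by (intro tendsto_intros lim)
    then have "\<forall>\<^sub>F n in sequentially. g (y n) < g z + e"
      by (rule order_tendstoD) (simp add: that)
    then have "\<forall>\<^sub>F n in sequentially. (g o\<^sub>L Blinfun K) (x n) \<le> g z + e"
      by eventually_elim (simp add: K x(2))
    from cl[OF this] show ?thesis by (simp add: K)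
  qed
  then have "g (K a) \<le> g z" by (rule field_le_epsilon)
  then have "norm (K a - z) \<le> 0" unfolding g(2)[symmetric] blinfun.diff_right by simp
  then have "K a = z" by simp
  with a show "z \<in> K ` cball 0 1" by auto
qed

section \<open>Birkhoff--James orthogonality of compact operators\<close>

lemma compact_operators_uminus:
  assumes "A \<in> compact_operators"
  shows "- A \<in> compact_operators"
  unfolding compact_operators_def
proof (intro CollectI allI impI)
  fix S :: "'a set" assume "bounded S"
  then have "compact (closure (A ` S))" using assms by (simp add: compact_operators_def)
  then have K: "compact (uminus ` closure (A ` S))" by (rule compact_negations)
  moreover have "closure ((- A) ` S) \<subseteq> uminus ` closure (A ` S)"
    using closure_subset[of "A ` S"]
    by (intro closure_minimal compact_imp_closed K) (auto simp: uminus_blinfun.rep_eq)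
  ultimately show "compact (closure ((- A) ` S))"
    using compact_Int_closed[OF K closed_closure, of "(- A) ` S"] by (simp add: Int_absorb1)
qed

text \<open>Compactness provides a subsequence along which both images converge; closedness of the
  image of the ball identifies the limits as values at a point of the ball.\<close>

lemma compact_operators_cluster_point:
  fixes T A :: "'a::real_normed_vector \<Rightarrow>\<^sub>L 'b::real_normed_vector"
    and x :: "nat \<Rightarrow> 'a"
  assumes "reflexive_space TYPE('a)" and "T \<in> compact_operators" "A \<in> compact_operators"
    and ball: "\<And>n. norm (x n) \<le> 1"
  obtains a r where "norm a \<le> 1" "strict_mono r"
    "(\<lambda>n. T (x (r n))) \<longlonglongrightarrow> T a" "(\<lambda>n. A (x (r n))) \<longlonglongrightarrow> A a"
proof -
  let ?B = "cball 0 1 :: 'a set"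
  let ?K = "\<lambda>u. (T u, A u)"
  have "compact (closure (T ` ?B) \<times> closure (A ` ?B))"
    using assms(2,3) by (intro compact_Times) (auto simp: compact_operators_def)
  then have "seq_compact (closure (T ` ?B) \<times> closure (A ` ?B))"
    by (rule compact_imp_seq_compact)
  moreover have "\<forall>n. ?K (x n) \<in> closure (T ` ?B) \<times> closure (A ` ?B)"
    using ball closure_subset[of "T ` ?B"] closure_subset[of "A ` ?B"] by auto
  ultimately obtain l r where "l \<in> closure (T ` ?B) \<times> closure (A ` ?B)"
    and r: "strict_mono r" and lim: "((\<lambda>n. ?K (x n)) \<circ> r) \<longlonglongrightarrow> l"
    by (rule seq_compactE)
  \<comment> \<open>Working with the pair map, rather than with \<open>T\<close> and
    \<open>A\<close> separately, is what yields one \<open>a\<close> for both operators.\<close>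
  have "closed (?K ` ?B)"
    by (intro reflexive_closed_image_cball assms(1) bounded_linear_Pair
        blinfun.bounded_linear_right)
  moreover have "\<forall>n. ((\<lambda>n. ?K (x n)) \<circ> r) n \<in> ?K ` ?B"
    using ball by auto
  ultimately have "l \<in> ?K ` ?B"
    using lim unfolding closed_sequential_limits by blast
  then obtain a where a: "norm a \<le> 1" "l = ?K a" by auto
  show thesis
    using tendsto_fst[OF lim] tendsto_snd[OF lim] a r
    by (intro that[of a r]) (simp_all add: o_def)
qed

text \<open>Otherwise \<open>norm S - e\<close> would be an operator bound for \<open>S\<close>, by
  rescaling vectors into the unit ball.\<close>

lemma blinfun_near_norm_attained:
  fixes S :: "'a::real_normed_vector \<Rightarrow>\<^sub>L 'b::real_normed_vector"
  assumes "e > 0"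
  shows "\<exists>x. norm x \<le> 1 \<and> norm S - e \<le> norm (S x)"
proof (rule ccontr)
  assume no: "\<not> ?thesis"
  have le: "norm (S x) \<le> norm S - e" if "norm x \<le> 1" for x
    using no that by (meson linear)
  have "0 \<le> norm S - e" using le[of 0] by simp
  moreover have "norm (S x) \<le> (norm S - e) * norm x" for x
  proof (cases "x = 0")
    case False
    then show ?thesis
      using le[of "x /\<^sub>R norm x"] by (simp add: blinfun.scaleR_right field_simps)
  qed simp
  ultimately have "norm S \<le> norm S - e" by (rule norm_blinfun_bound)
  with assms show False by simp
qed

text \<open>Convexity along the ray: \<open>u + s *\<^sub>R v\<close> is the convex combination of
  \<open>u\<close> and \<open>u + l *\<^sub>R v\<close> with weights \<open>1 - s / l\<close> and
  \<open>s / l\<close>. Dividing by \<open>s / l\<close> turns the error \<open>s\<^sup>2\<close>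
  into \<open>l * s\<close>, which still vanishes with \<open>s\<close>.\<close>

lemma norm_ray_ge:
  fixes u v :: "'b::real_normed_vector"
  assumes "norm u \<le> N" "N - s\<^sup>2 \<le> norm (u + s *\<^sub>R v)" "0 < s" "s \<le> l"
  shows "N - l * s \<le> norm (u + l *\<^sub>R v)"
proof -
  have "u + s *\<^sub>R v = (1 - s / l) *\<^sub>R u + (s / l) *\<^sub>R (u + l *\<^sub>R v)"
    using assms by (simp add: algebra_simps)
  then have "norm (u + s *\<^sub>R v) \<le> (1 - s / l) * norm u + (s / l) * norm (u + l *\<^sub>R v)"
    using assms norm_triangle_ineq[of "(1 - s / l) *\<^sub>R u" "(s / l) *\<^sub>R (u + l *\<^sub>R v)"]
    by (simp add: abs_of_nonneg)
  also have "\<dots> \<le> (1 - s / l) * N + (s / l) * norm (u + l *\<^sub>R v)"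
    using assms by (intro add_right_mono mult_left_mono) auto
  finally have "N - s\<^sup>2 \<le> (1 - s / l) * N + (s / l) * norm (u + l *\<^sub>R v)"
    using assms(2) by linarith
  then have "(s / l) * (N - l * s) \<le> (s / l) * norm (u + l *\<^sub>R v)"
    using assms by (simp add: field_simps power2_eq_square)
  then show ?thesis using assms by (subst (asm) mult_le_cancel_left_pos) auto
qed

text \<open>Orthogonality is assumed only for nonnegative \<open>l\<close>, so the lemma serves for
  \<open>A\<close> and for \<open>- A\<close> alike.\<close>

lemma norm_attained_in_plus_set:
  fixes T A :: "'a::real_normed_vector \<Rightarrow>\<^sub>L 'b::real_normed_vector"
  assumes "reflexive_space TYPE('a)" and "(UNIV :: 'a set) \<noteq> {0}"
    and "T \<in> compact_operators" "A \<in> compact_operators"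
    and orth: "\<And>l. l \<ge> 0 \<Longrightarrow> norm T \<le> norm (T + l *\<^sub>R A)"
  shows "\<exists>x\<in>norm_attainment_set T. A x \<in> plus_set (T x)"
proof (cases "T = 0")
  case True
  \<comment> \<open>The zero operator attains its norm at every unit vector; a nontrivial domain is
    needed for one to exist.\<close>
  obtain v :: 'a where "v \<noteq> 0" using assms(2) by auto
  then have "sgn v \<in> norm_attainment_set T"
    by (simp add: True norm_attainment_set_def norm_sgn)
  then show ?thesis by (auto simp: True plus_set_def)
next
  case False
  define s where "s n = inverse (real (Suc n))" for n
  have s: "s n > 0" for n by (simp add: s_def)
  have s_lim: "s \<longlonglongrightarrow> 0" unfolding s_def by (rule LIMSEQ_inverse_real_of_nat)
  have "\<exists>x. norm x \<le> 1 \<and> norm (T + s n *\<^sub>R A) - (s n)\<^sup>2 \<le> norm ((T + s n *\<^sub>R A) x)" for n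
    using s[of n] by (intro blinfun_near_norm_attained) simp
  then obtain x where ball: "\<And>n. norm (x n) \<le> 1"
    and x: "\<And>n. norm (T + s n *\<^sub>R A) - (s n)\<^sup>2 \<le> norm ((T + s n *\<^sub>R A) (x n))"
    by metis
  have T_le: "norm (T u) \<le> norm T" if "norm u \<le> 1" for u
    using norm_blinfun[of T u] mult_left_mono[OF that norm_ge_zero[of T]] by simp
  obtain a r where a: "norm a \<le> 1" and r: "strict_mono r"
    and lim: "(\<lambda>n. T (x (r n))) \<longlonglongrightarrow> T a" "(\<lambda>n. A (x (r n))) \<longlonglongrightarrow> A a"
    by (rule compact_operators_cluster_point[where x = x, OF assms(1,3,4) ball])
  have sr: "(\<lambda>n. s (r n)) \<longlonglongrightarrow> 0"
    using LIMSEQ_subseq_LIMSEQ[OF s_lim r] by (simp add: o_def)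
  have ray: "norm T \<le> norm (T a + l *\<^sub>R A a)" if "l > 0" for l
  proof (rule tendsto_le[OF sequentially_bot])
    show "(\<lambda>n. norm (T (x (r n)) + l *\<^sub>R A (x (r n)))) \<longlonglongrightarrow> norm (T a + l *\<^sub>R A a)"
      by (intro tendsto_intros lim)
    show "(\<lambda>n. norm T - l * s (r n)) \<longlonglongrightarrow> norm T"
      using tendsto_diff[OF tendsto_const tendsto_mult_left[OF sr]] by fastforce
    have "\<forall>\<^sub>F n in sequentially. s (r n) < l"
      using sr that by (rule order_tendstoD)
    then show "\<forall>\<^sub>F n in sequentially. norm T - l * s (r n) \<le> norm (T (x (r n)) + l *\<^sub>R A (x (r n)))"
    proof eventually_elim
      case (elim n)
      have "norm T - (s (r n))\<^sup>2 \<le> norm (T (x (r n)) + s (r n) *\<^sub>R A (x (r n)))"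
        using x[of "r n"] orth[of "s (r n)"] s[of "r n"]
        by (simp add: plus_blinfun.rep_eq scaleR_blinfun.rep_eq)
      then show ?case
        using elim s by (intro norm_ray_ge T_le ball) auto
    qed
  qed
  \<comment> \<open>Letting \<open>l\<close> tend to 0 from the right in \<open>ray\<close> shows
    that \<open>T\<close> attains its norm at \<open>a\<close>.\<close>
  have "(\<lambda>l. norm (T a + l *\<^sub>R A a)) \<midarrow>0\<rightarrow> norm (T a + 0 *\<^sub>R A a)"
    by (intro tendsto_intros)
  then have "((\<lambda>l. norm (T a + l *\<^sub>R A a)) \<longlongrightarrow> norm (T a)) (at_right 0)"
    by (auto intro: tendsto_mono[OF at_le])
  then have "norm T \<le> norm (T a)"
    by (rule tendsto_lowerbound) (auto simp: ray eventually_at_right_less intro: eventually_mono[OF eventually_at_right_less])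
  with T_le[OF a] have eq: "norm (T a) = norm T" by simp
  \<comment> \<open>Cancelling \<open>norm T > 0\<close> puts \<open>a\<close> on the sphere, not
    merely in the ball.\<close>
  have "norm T * 1 \<le> norm T * norm a" using norm_blinfun[of T a] eq by simp
  then have "norm a = 1" using False a by (simp add: mult_le_cancel_left_pos)
  with eq have "a \<in> norm_attainment_set T" by (simp add: norm_attainment_set_def)
  moreover have "A a \<in> plus_set (T a)"
    unfolding plus_set_def eq
    using ray eq by (auto simp: le_less)
  ultimately show ?thesis by blast
qed

theorem theorem2p1:
  fixes T A :: "'a::banach \<Rightarrow>\<^sub>L 'b::real_normed_vector"
  assumes "reflexive_space TYPE('a)"
    and "(UNIV :: 'a set) \<noteq> {0}"
    and "T \<in> compact_operators" and "A \<in> compact_operators"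
  shows "birkhoff_james_orthogonal T A \<longleftrightarrow>
    (\<exists>x\<in>norm_attainment_set T. \<exists>y\<in>norm_attainment_set T.
       blinfun_apply A x \<in> plus_set (blinfun_apply T x) \<and>
       blinfun_apply A y \<in> minus_set (blinfun_apply T y))"
proof
  assume orth: "birkhoff_james_orthogonal T A"
  then have "\<exists>x\<in>norm_attainment_set T. A x \<in> plus_set (T x)"
    by (intro norm_attained_in_plus_set assms) (simp add: birkhoff_james_orthogonal_def)
  moreover have "\<exists>y\<in>norm_attainment_set T. (- A) y \<in> plus_set (T y)"
  proof (intro norm_attained_in_plus_set assms compact_operators_uminus)
    show "norm T \<le> norm (T + l *\<^sub>R (- A))" for l
      using orth[unfolded birkhoff_james_orthogonal_def, rule_format, of "- l"] by simp
  qed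
  moreover have "A y \<in> minus_set (T y)" if "(- A) y \<in> plus_set (T y)" for y
    unfolding minus_set_def
  proof (intro CollectI allI impI)
    fix l :: real assume "l \<le> 0"
    with that[unfolded plus_set_def, simplified, rule_format, of "- l"]
    show "norm (T y) \<le> norm (T y + l *\<^sub>R A y)" by (simp add: uminus_blinfun.rep_eq)
  qed
  ultimately show "\<exists>x\<in>norm_attainment_set T. \<exists>y\<in>norm_attainment_set T.
      A x \<in> plus_set (T x) \<and> A y \<in> minus_set (T y)"
    by blast
next
  assume "\<exists>x\<in>norm_attainment_set T. \<exists>y\<in>norm_attainment_set T.
      A x \<in> plus_set (T x) \<and> A y \<in> minus_set (T y)"
  then obtain x y where x: "x \<in> norm_attainment_set T" "A x \<in> plus_set (T x)"
    and y: "y \<in> norm_attainment_set T" "A y \<in> minus_set (T y)"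
    by blast
  \<comment> \<open>Evaluation at a unit vector where \<open>T\<close> attains its norm bounds
    \<open>norm (T + l *\<^sub>R A)\<close> from below; \<open>x\<close> settles
    \<open>l \<ge> 0\<close> and \<open>y\<close> settles negative \<open>l\<close>.\<close>
  have bound: "norm T \<le> norm (T + l *\<^sub>R A)"
    if "z \<in> norm_attainment_set T" "norm (T z) \<le> norm (T z + l *\<^sub>R A z)" for z l
    using norm_blinfun[of "T + l *\<^sub>R A" z] that
    by (simp add: norm_attainment_set_def plus_blinfun.rep_eq scaleR_blinfun.rep_eq)
  show "birkhoff_james_orthogonal T A"
    unfolding birkhoff_james_orthogonal_def
  proof
    fix l :: real
    show "norm T \<le> norm (T + l *\<^sub>R A)"
      using x(2) y(2) bound[OF x(1), of l] bound[OF y(1), of l]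
      by (cases "l \<ge> 0") (auto simp: plus_set_def minus_set_def)
  qed
qed

end
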